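(* Let $(x_n)_{n\in\mathbb{N}}$ be points in a Hadamard space $(H,d)$, and let $b_n$ be the barycenter of $x_1,\dots,x_n$. Let $Y_1,Y_2,\dots$ be independent random variables such that $Y_k$ is drawn uniformly from $\{x_1,\dots,x_k\}$ for each $k$, and define $M_1=Y_1$ and $M_n=M_{n-1}\oplus_{\frac1n}Y_n$ for $n\ge2$. If there is $\mu\in H$ such that $$\frac1n\sum_{k=1}^n d(b_k,\mu)=O(n^{-p})$$ for some $p>\frac12$, and if there is $z\in H$ such that, for some $C>0$ and $0\le q<\min\{\frac14,\,p-\frac12\}$, $x_1,\dots,x_n\in B_{Cn^q}(z)$ for all $n\ge1$, then $M_n\to\mu$ almost surely.
   Context: A Hadamard space is a complete metric space $(H,d)$ such that for all $x,y\in H$ there is $m\in H$ with $d(z,m)^2\le\frac12 d(z,x)^2+\frac12 d(z,y)^2-\frac14 d(x,y)^2$ for all $z\in H$. Any two points $x,y\in H$ are joined by a unique minimal geodesic, i.e. a map $\gamma:[0,1]\to H$ with $\gamma(0)=x$, $\gamma(1)=y$, $d(\gamma(s),\gamma(t))=|t-s|\,d(x,y)$; write $x\oplus_t y=\gamma(t)$. The barycenter (Fréchet mean) of $x_1,\dots,x_n\in H$ is the unique minimizer $b_n=\operatorname{arg\,min}_{z\in H}\frac1n\sum_{k=1}^n d(x_k,z)^2$. $B_r(z)$ is the ball of radius $r$ centered at $z$ (open or closed is immaterial, since $C$ is arbitrary). "$Y_k$ uniform on $\{x_1,\dots,x_k\}$" means that each index $i\in\{1,\dots,k\}$ is selected with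 probability $1/k$ (points counted with multiplicity). *)

theory Defs
  imports "HOL-Probability.Probability" "HOL-Library.Landau_Symbols"
begin

class hadamard_space = complete_space +
  assumes ex_midpoint_ineq:
    "\<exists>m. \<forall>z. (dist z m)\<^sup>2 \<le> (dist z x)\<^sup>2 / 2 + (dist z y)\<^sup>2 / 2 - (dist x y)\<^sup>2 / 4"

definition minimal_geodesic :: "(real \<Rightarrow> 'a::metric_space) \<Rightarrow> 'a \<Rightarrow> 'a \<Rightarrow> bool" where
  "minimal_geodesic \<gamma> x y \<longleftrightarrow> \<gamma> 0 = x \<and> \<gamma> 1 = y \<and>
     (\<forall>s\<in>{0..1}. \<forall>t\<in>{0..1}. dist (\<gamma> s) (\<gamma> t) = \<bar>t - s\<bar> * dist x y)"

(* Only the point at parameter t is selected by THE: the geodesic itself is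
   unique only up to its values outside [0,1]. Meaningful for t in [0,1]. *)
definition geodesic_point :: "'a::hadamard_space \<Rightarrow> real \<Rightarrow> 'a \<Rightarrow> 'a" where
  "geodesic_point x t y = (THE p. \<exists>\<gamma>. minimal_geodesic \<gamma> x y \<and> p = \<gamma> t)"

(* Meaningful for n >= 1, where the minimizer exists and is unique. *)
definition barycenter :: "(nat \<Rightarrow> 'a::hadamard_space) \<Rightarrow> nat \<Rightarrow> 'a" where
  "barycenter x n = arg_min (\<lambda>z. (1 / real n) * (\<Sum>k=1..n. (dist (x k) z)\<^sup>2)) (\<lambda>_. True)"

end

theory Submission
  imports Defs
begin

text \<open>
Let \<epsilon>_n = d(b_n, \<mu>), let R_n = C n^q be the radius of the ball that contains x_1, ..., x_n, and let
v_n = d(M_n, \<mu>)^2. The whole argument is a recursion for E v_n that contracts fast enough for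
almost sure convergence along the squares.

Geometry. The midpoint inequality in the definition of a Hadamard space extends to every point of
a geodesic (\<open>geodesic_point_ineq\<close>). Averaged over the data it makes the Frechet functional
F_n(z) = (1/n) \<Sum> d(x_k, z)^2 strongly convex, so that F_n has a minimizer b_n and grows
quadratically around it: F_n(b_n) + d(z, b_n)^2 \<le> F_n(z) (\<open>variance_inequality\<close>). Applied to the point
at parameter 1/n between the current mean u and a uniformly chosen x_i, the geodesic inequality bounds
the average new squared distance to \<mu> by
(1 - 1/n) d(u, \<mu>)^2 + (1/n) (F_n(\<mu>) - F_n(u)) + F_n(u)/n^2. The quadratic growth contributes a
second term -d(u, \<mu>)^2/n, up to an error of order \<epsilon>_n R_n/n caused by \<mu> not being b_n
(\<open>mean_square_after_step_le\<close>).

Expectation. Y_n is independent of M_(n-1), hence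
E v_n \<le> (1 - 2/n) E v_(n-1) + O(n^(q-1) \<epsilon>_n + n^(2q-2)) (\<open>expected_square_after_step_le\<close>). Multiplying
by n(n-1) makes the recursion telescope, and the remaining sum sees only the averages of the \<epsilon>_k.
The hypothesis on these averages gives E v_n = O(n^(q-p) + n^(2q-1)), where both exponents are below
-1/2 because q < p - 1/2 and q < 1/4. So the expectations E v_n are summable along n = k^2
(\<open>summable_square_subsequence_of_recursion\<close>), and M_n tends to \<mu> almost surely along the squares.

Gaps. One step moves the mean by at most 2 R_n/n = O(n^(q-1)), and at most 2k steps lead from k^2
to an index below (k+1)^2, so that between consecutive squares the mean moves by O(k^(2q-1)), which tends to 0
(\<open>tendsto_of_square_subsequence\<close>).

Measurability. H may be non-separable, so that neither the distance of two random points nor a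
geodesic point of them need be measurable for the Borel algebra. But Y_k lies almost surely in the finite
set {x_1, ..., x_k}. Retracting Y_k to this set gives variables with values in finite discrete spaces, on
whose products every function is measurable.
\<close>

section \<open>Geodesics in Hadamard spaces\<close>

text \<open>
The CN inequality of Bruhat and Tits, for a point that divides the pair x, y in the ratio t : 1 - t.
Requiring it for all z at once pins the point down and carries over to midpoints and to limits,
whereas the two distance equations alone do not obviously carry over to midpoints.
\<close>

definition cn_point :: "'a::metric_space \<Rightarrow> 'a \<Rightarrow> real \<Rightarrow> 'a \<Rightarrow> bool" where
  "cn_point x y t p \<longleftrightarrow>
     (\<forall>z. (dist z p)\<^sup>2 \<le> (1 - t) * (dist z x)\<^sup>2 + t * (dist z y)\<^sup>2 - t * (1 - t) * (dist x y)\<^sup>2)"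

lemma cn_pointD:
  "cn_point x y t p \<Longrightarrow>
     (dist z p)\<^sup>2 \<le> (1 - t) * (dist z x)\<^sup>2 + t * (dist z y)\<^sup>2 - t * (1 - t) * (dist x y)\<^sup>2"
  by (auto simp: cn_point_def)

text \<open>
The choices z = x and z = y bound the two distances from above, and the triangle inequality leaves no
slack.
\<close>

lemma cn_point_dist:
  assumes "cn_point x y t p" "t \<in> {0..1}"
  shows "dist x p = t * dist x y" "dist y p = (1 - t) * dist x y"
proof -
  have "t * (dist x y)\<^sup>2 - t * (1 - t) * (dist x y)\<^sup>2 = (t * dist x y)\<^sup>2"
    "(1 - t) * (dist x y)\<^sup>2 - t * (1 - t) * (dist x y)\<^sup>2 = ((1 - t) * dist x y)\<^sup>2"
    by (auto simp: power2_eq_square algebra_simps)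
  then have "(dist x p)\<^sup>2 \<le> (t * dist x y)\<^sup>2" "(dist y p)\<^sup>2 \<le> ((1 - t) * dist x y)\<^sup>2"
    using cn_pointD[OF assms(1), of x] cn_pointD[OF assms(1), of y] by (simp_all add: dist_commute)
  then have 1: "dist x p \<le> t * dist x y" and 2: "dist y p \<le> (1 - t) * dist x y"
    using assms(2) by (auto intro: power2_le_imp_le)
  have 3: "dist x y \<le> dist x p + dist y p"
    by (metis dist_triangle2)
  show "dist x p = t * dist x y" "dist y p = (1 - t) * dist x y"
    using 1 2 3 by (auto simp: algebra_simps)
qed

lemma cn_point_unique:
  assumes "cn_point x y t p" "dist x p' = t * dist x y" "dist y p' = (1 - t) * dist x y"
  shows "p' = p"
proof -
  have "(dist p' p)\<^sup>2 \<le> (1 - t) * (t * dist x y)\<^sup>2 + t * ((1 - t) * dist x y)\<^sup>2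
      - t * (1 - t) * (dist x y)\<^sup>2"
    using cn_pointD[OF assms(1), of p'] assms(2,3) by (simp add: dist_commute)
  also have "\<dots> = 0"
    by (simp add: power2_eq_square algebra_simps)
  finally show ?thesis by simp
qed

lemma cn_point_dist_cn_point:
  assumes "cn_point x y s p" "s \<in> {0..1}" "cn_point x y t p'" "t \<in> {0..1}"
  shows "dist p p' = \<bar>t - s\<bar> * dist x y"
proof (rule antisym)
  note d = cn_point_dist[OF assms(1,2)] cn_point_dist[OF assms(3,4)]
  have "(dist p p')\<^sup>2 \<le> (1 - t) * (s * dist x y)\<^sup>2 + t * ((1 - s) * dist x y)\<^sup>2
      - t * (1 - t) * (dist x y)\<^sup>2"
    using cn_pointD[OF assms(3), of p] d by (simp add: dist_commute)
  also have "\<dots> = (\<bar>t - s\<bar> * dist x y)\<^sup>2"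
    unfolding power_mult_distrib power2_abs by (simp add: power2_eq_square algebra_simps)
  finally show "dist p p' \<le> \<bar>t - s\<bar> * dist x y"
    by (rule power2_le_imp_le) auto
  have "dist x p' \<le> dist x p + dist p p'" "dist y p' \<le> dist y p + dist p p'"
    by (rule dist_triangle)+
  then have "(t - s) * dist x y \<le> dist p p'" "(s - t) * dist x y \<le> dist p p'"
    using d by (auto simp: algebra_simps)
  then show "\<bar>t - s\<bar> * dist x y \<le> dist p p'"
    by (auto simp: abs_if)
qed

lemma cn_point_midpoint:
  fixes x y :: "'a::hadamard_space"
  assumes "cn_point x y s p" "s \<in> {0..1}" "cn_point x y t p'" "t \<in> {0..1}"
  shows "\<exists>m. cn_point x y ((s + t) / 2) m"
proof -
  obtain m where m: "\<And>z. (dist z m)\<^sup>2 \<le> (dist z p)\<^sup>2 / 2 + (dist z p')\<^sup>2 / 2 - (dist p p')\<^sup>2 / 4"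
    using ex_midpoint_ineq[of p p'] by auto
  have "(dist z m)\<^sup>2 \<le> (1 - (s+t)/2) * (dist z x)\<^sup>2 + ((s+t)/2) * (dist z y)\<^sup>2
          - ((s+t)/2) * (1 - (s+t)/2) * (dist x y)\<^sup>2" for z
  proof -
    have e: "(dist p p')\<^sup>2 = (t - s)\<^sup>2 * (dist x y)\<^sup>2"
      using cn_point_dist_cn_point[OF assms] by (simp add: power_mult_distrib)
    have "(dist z m)\<^sup>2 \<le>
      ((1 - s) * (dist z x)\<^sup>2 + s * (dist z y)\<^sup>2 - s * (1 - s) * (dist x y)\<^sup>2) / 2
      + ((1 - t) * (dist z x)\<^sup>2 + t * (dist z y)\<^sup>2 - t * (1 - t) * (dist x y)\<^sup>2) / 2
      - (t - s)\<^sup>2 * (dist x y)\<^sup>2 / 4"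
      using cn_pointD[OF assms(1), of z] cn_pointD[OF assms(3), of z]
      by (intro order_trans[OF m[of z, unfolded e]] diff_right_mono add_mono divide_right_mono) auto
    also have "\<dots> = (1 - (s+t)/2) * (dist z x)\<^sup>2 + ((s+t)/2) * (dist z y)\<^sup>2
          - ((s+t)/2) * (1 - (s+t)/2) * (dist x y)\<^sup>2"
      unfolding power2_eq_square[of "t - s"] by (simp add: field_simps)
    finally show ?thesis .
  qed
  then show ?thesis unfolding cn_point_def by blast
qed

text \<open>
Points with nearby parameters are nearby, by \<open>cn_point_dist_cn_point\<close>, so completeness provides a limit
point, and the inequality is preserved in the limit.
\<close>

lemma closed_cn_parameters:
  fixes x y :: "'a::hadamard_space"
  shows "closed {t \<in> {0..1}. \<exists>p. cn_point x y t p}"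
  unfolding closed_sequential_limits
proof (intro allI impI, elim conjE)
  fix f :: "nat \<Rightarrow> real" and t
  assume f: "\<forall>n. f n \<in> {t \<in> {0..1}. \<exists>p. cn_point x y t p}" and lim: "f \<longlonglongrightarrow> t"
  have f01: "f n \<in> {0..1}" for n using f by auto
  have t01: "t \<in> {0..1}"
    using closed_sequentially[OF closed_atLeastAtMost f01 lim] .
  obtain P where P: "\<And>n. cn_point x y (f n) (P n)"
    using f by simp metis
  have "Cauchy P"
  proof (rule metric_CauchyI)
    fix e :: real assume e: "e > 0"
    have "Cauchy f" using lim by (rule LIMSEQ_imp_Cauchy)
    then obtain N where N: "\<And>m n. m \<ge> N \<Longrightarrow> n \<ge> N \<Longrightarrow> dist (f m) (f n) < e / (dist x y + 1)"
      using e by (metis Cauchy_def add_pos_nonneg add.commute zero_less_one zero_le_dist divide_pos_pos)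
    have "dist (P m) (P n) < e" if "m \<ge> N" "n \<ge> N" for m n
    proof -
      have "dist (P m) (P n) = \<bar>f n - f m\<bar> * dist x y"
        by (rule cn_point_dist_cn_point[OF P f01 P f01])
      also have "\<dots> \<le> \<bar>f n - f m\<bar> * (dist x y + 1)"
        by (intro mult_left_mono) auto
      also have "\<bar>f n - f m\<bar> < e / (dist x y + 1)"
        using N[OF that(2,1)] by (simp add: dist_real_def)
      then have "\<bar>f n - f m\<bar> * (dist x y + 1) < e"
        by (simp add: pos_less_divide_eq add_nonneg_pos)
      finally show ?thesis .
    qed
    then show "\<exists>N. \<forall>m\<ge>N. \<forall>n\<ge>N. dist (P m) (P n) < e" by blast
  qed
  then obtain p where p: "P \<longlonglongrightarrow> p"
    by (meson Cauchy_convergent convergentD)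
  have "cn_point x y t p"
    unfolding cn_point_def
  proof
    fix z
    have "(\<lambda>n. (dist z (P n))\<^sup>2) \<longlonglongrightarrow> (dist z p)\<^sup>2"
      by (intro tendsto_intros p)
    moreover have "(\<lambda>n. (1 - f n) * (dist z x)\<^sup>2 + f n * (dist z y)\<^sup>2 - f n * (1 - f n) * (dist x y)\<^sup>2)
      \<longlonglongrightarrow> (1 - t) * (dist z x)\<^sup>2 + t * (dist z y)\<^sup>2 - t * (1 - t) * (dist x y)\<^sup>2"
      by (intro tendsto_intros lim)
    ultimately show "(dist z p)\<^sup>2 \<le> (1 - t) * (dist z x)\<^sup>2 + t * (dist z y)\<^sup>2 - t * (1 - t) * (dist x y)\<^sup>2"
      by (rule LIMSEQ_le) (auto intro: cn_pointD[OF P])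
  qed
  then show "t \<in> {t \<in> {0..1}. \<exists>p. cn_point x y t p}" using t01 by auto
qed

text \<open>
If t is missing, then the midpoint of the two neighbours of t in the set closes part of the gap between
them, a contradiction.
\<close>

lemma closed_midpoint_set_contains_interval:
  fixes T :: "real set"
  assumes "closed T" and ab: "a \<in> T" "b \<in> T"
    and mid: "\<And>s t. s \<in> T \<Longrightarrow> t \<in> T \<Longrightarrow> (s + t) / 2 \<in> T"
  shows "{a..b} \<subseteq> T"
proof
  fix t assume t: "t \<in> {a..b}"
  define l where "l = Sup (T \<inter> {a..t})"
  define u where "u = Inf (T \<inter> {t..b})"
  have l: "l \<in> T \<inter> {a..t}"
    unfolding l_def using t ab \<open>closed T\<close> by (intro closed_contains_Sup) auto
  have u: "u \<in> T \<inter> {t..b}"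
    unfolding u_def using t ab \<open>closed T\<close> by (intro closed_contains_Inf) auto
  have lmax: "s \<le> l" if "s \<in> T" "s \<in> {a..t}" for s
    unfolding l_def using that by (intro cSup_upper) auto
  have umin: "u \<le> s" if "s \<in> T" "s \<in> {t..b}" for s
    unfolding u_def using that by (intro cInf_lower) auto
  have "(l + u) / 2 \<in> T" using mid l u by auto
  then have "l = t \<or> u = t"
    using l u lmax[of "(l + u) / 2"] umin[of "(l + u) / 2"]
    by (cases "(l + u) / 2 \<le> t") auto
  then show "t \<in> T" using l u by auto
qed

lemma ex_cn_point:
  fixes x y :: "'a::hadamard_space"
  assumes "t \<in> {0..1}"
  shows "\<exists>p. cn_point x y t p"
proof -
  let ?T = "{t \<in> {0..1}. \<exists>p. cn_point x y t p}"
  have "{0..1} \<subseteq> ?T"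
  proof (rule closed_midpoint_set_contains_interval[OF closed_cn_parameters])
    show "0 \<in> ?T" "1 \<in> ?T"
      by (auto simp: cn_point_def intro: exI[of _ x] exI[of _ y])
    show "(s + t) / 2 \<in> ?T" if "s \<in> ?T" "t \<in> ?T" for s t
      using that cn_point_midpoint[of x y s _ t] by auto
  qed
  then show ?thesis using assms by auto
qed

text \<open>
A choice of division points for all parameters is a minimal geodesic. Every other minimal geodesic
satisfies the same distance equations and therefore agrees with it on [0, 1], so the definite
description in \<open>geodesic_point\<close> is well defined.
\<close>

lemma cn_point_geodesic_point:
  fixes x y :: "'a::hadamard_space"
  assumes "t \<in> {0..1}"
  shows "cn_point x y t (geodesic_point x t y)"
proof -
  obtain \<gamma> where \<gamma>: "\<And>t. t \<in> {0..1} \<Longrightarrow> cn_point x y t (\<gamma> t)"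
    using ex_cn_point[of _ x y] by metis
  have "\<gamma> 0 = x" "\<gamma> 1 = y"
    using cn_point_dist(1)[OF \<gamma>[of 0]] cn_point_dist(2)[OF \<gamma>[of 1]] by auto
  moreover have "\<forall>s\<in>{0..1}. \<forall>t\<in>{0..1}. dist (\<gamma> s) (\<gamma> t) = \<bar>t - s\<bar> * dist x y"
    by (intro ballI cn_point_dist_cn_point \<gamma>)
  ultimately have "minimal_geodesic \<gamma> x y"
    unfolding minimal_geodesic_def by simp
  moreover have "p = \<gamma> t" if ex: "\<exists>\<gamma>. minimal_geodesic \<gamma> x y \<and> p = \<gamma> t" for p
  proof -
    obtain \<delta> where d: "minimal_geodesic \<delta> x y" "p = \<delta> t" using ex by auto
    then have "dist x p = t * dist x y" "dist y p = (1 - t) * dist x y"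
      using assms unfolding minimal_geodesic_def
      by (metis (no_types, lifting) abs_of_nonneg atLeastAtMost_iff diff_ge_0_iff_ge diff_zero
            dist_commute order_refl zero_le_one)+
    then show ?thesis by (rule cn_point_unique[OF \<gamma>[OF assms]])
  qed
  ultimately have "geodesic_point x t y = \<gamma> t"
    unfolding geodesic_point_def by (intro the_equality) blast+
  then show ?thesis using \<gamma>[OF assms] by simp
qed

lemma geodesic_point_ineq:
  fixes x y z :: "'a::hadamard_space"
  assumes "t \<in> {0..1}"
  shows "(dist z (geodesic_point x t y))\<^sup>2
     \<le> (1 - t) * (dist z x)\<^sup>2 + t * (dist z y)\<^sup>2 - t * (1 - t) * (dist x y)\<^sup>2"
  using cn_pointD[OF cn_point_geodesic_point[OF assms]] .

lemma geodesic_point_in_cball: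
  fixes x y z :: "'a::hadamard_space"
  assumes "t \<in> {0..1}" "x \<in> cball z r" "y \<in> cball z r"
  shows "geodesic_point x t y \<in> cball z r"
proof -
  have r: "r \<ge> 0" using assms(2) by (metis mem_cball order_trans zero_le_dist)
  have "(dist z (geodesic_point x t y))\<^sup>2
      \<le> (1 - t) * (dist z x)\<^sup>2 + t * (dist z y)\<^sup>2 - t * (1 - t) * (dist x y)\<^sup>2"
    by (rule geodesic_point_ineq[OF assms(1)])
  also have "\<dots> \<le> (1 - t) * r\<^sup>2 + t * r\<^sup>2 - 0"
    using assms by (intro diff_mono add_mono mult_left_mono power_mono) auto
  also have "\<dots> = r\<^sup>2" by (simp add: algebra_simps)
  finally show ?thesis using r by (auto intro: power2_le_imp_le)
qed

lemma dist_geodesic_point_left: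
  fixes x y :: "'a::hadamard_space"
  shows "t \<in> {0..1} \<Longrightarrow> dist x (geodesic_point x t y) = t * dist x y"
  by (rule cn_point_dist(1)[OF cn_point_geodesic_point])

lemma geodesic_point_1: "geodesic_point x 1 y = (y :: 'a::hadamard_space)"
proof -
  have "cn_point x y 1 (geodesic_point x 1 y)" by (rule cn_point_geodesic_point) simp
  from cn_point_dist(2)[OF this] show ?thesis by simp
qed

section \<open>Barycenters\<close>

definition frechet_functional :: "(nat \<Rightarrow> 'a::metric_space) \<Rightarrow> nat \<Rightarrow> 'a \<Rightarrow> real" where
  "frechet_functional x n z = (1 / real n) * (\<Sum>k=1..n. (dist (x k) z)\<^sup>2)"

lemma frechet_nonneg: "frechet_functional x n z \<ge> 0"
  unfolding frechet_functional_def by (intro mult_nonneg_nonneg sum_nonneg) auto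

lemma frechet_geodesic_point:
  fixes x :: "nat \<Rightarrow> 'a::hadamard_space"
  assumes "n \<ge> 1" "t \<in> {0..1}"
  shows "frechet_functional x n (geodesic_point u t v)
    \<le> (1 - t) * frechet_functional x n u + t * frechet_functional x n v - t * (1 - t) * (dist u v)\<^sup>2"
proof -
  have "frechet_functional x n (geodesic_point u t v) \<le> (1 / real n) *
     (\<Sum>k=1..n. (1 - t) * (dist (x k) u)\<^sup>2 + t * (dist (x k) v)\<^sup>2 - t * (1 - t) * (dist u v)\<^sup>2)"
    unfolding frechet_functional_def
    by (intro mult_left_mono sum_mono geodesic_point_ineq assms) auto
  also have "\<dots> = (1 - t) * frechet_functional x n u + t * frechet_functional x n v - t * (1 - t) * (dist u v)\<^sup>2"
    using assms(1) unfolding frechet_functional_def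
    by (simp add: sum_subtractf sum.distrib sum_distrib_left[symmetric] field_simps)
  finally show ?thesis .
qed

text \<open>
The functional attains its infimum: by strong convexity at t = 1/2, the distance of two almost minimizers
is small, so a minimizing sequence is Cauchy. Hence the minimum property selected by \<open>arg_min\<close> is
satisfied.
\<close>

lemma frechet_barycenter_le:
  fixes x :: "nat \<Rightarrow> 'a::hadamard_space"
  assumes n: "n \<ge> 1"
  shows "frechet_functional x n (barycenter x n) \<le> frechet_functional x n z"
proof -
  let ?F = "frechet_functional x n"
  define I where "I = (INF z. ?F z)"
  have bdd: "bdd_below (range ?F)"
    by (rule bdd_belowI[of _ 0]) (auto simp: frechet_nonneg)
  have I: "I \<le> ?F z" for z
    unfolding I_def by (rule cINF_lower[OF bdd]) auto
  have "\<exists>z. ?F z < I + inverse (real (Suc k))" for k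
  proof -
    have "Inf (range ?F) < I + inverse (real (Suc k))"
      unfolding I_def by auto
    then show ?thesis
      using cInf_lessD[of "range ?F"] by auto
  qed
  then obtain u where u: "\<And>k. ?F (u k) < I + inverse (real (Suc k))" by metis
  have d: "(dist (u j) (u k))\<^sup>2 \<le> 2 * (inverse (real (Suc j)) + inverse (real (Suc k)))" for j k
    using frechet_geodesic_point[OF n, of "1/2" x "u j" "u k"] u[of j] u[of k]
      I[of "geodesic_point (u j) (1/2) (u k)"]
    by simp
  have "Cauchy u"
  proof (rule metric_CauchyI)
    fix e :: real assume e: "e > 0"
    then obtain N where N: "inverse (real (Suc N)) < e\<^sup>2 / 4"
      using reals_Archimedean[of "e\<^sup>2 / 4"] by auto
    have "dist (u j) (u k) < e" if "j \<ge> N" "k \<ge> N" for j k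
    proof -
      have "inverse (real (Suc j)) + inverse (real (Suc k)) \<le> 2 * inverse (real (Suc N))"
        using that unfolding mult_2 by (intro add_mono) (auto intro!: le_imp_inverse_le)
      also have "\<dots> < e\<^sup>2 / 2" using N by simp
      finally have "(dist (u j) (u k))\<^sup>2 < e\<^sup>2"
        using d[of j k] by simp
      then show ?thesis using e by (auto intro: power2_less_imp_less)
    qed
    then show "\<exists>N. \<forall>m\<ge>N. \<forall>n\<ge>N. dist (u m) (u n) < e" by blast
  qed
  then obtain b where b: "u \<longlonglongrightarrow> b"
    by (meson Cauchy_convergent convergentD)
  have "(\<lambda>k. ?F (u k)) \<longlonglongrightarrow> ?F b"
    unfolding frechet_functional_def by (intro tendsto_intros b)
  moreover have "(\<lambda>k. I + inverse (real (Suc k))) \<longlonglongrightarrow> I + 0"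
    by (intro tendsto_intros LIMSEQ_inverse_real_of_nat)
  ultimately have "?F b \<le> I + 0"
    by (rule LIMSEQ_le) (intro exI allI impI less_imp_le u)
  then have "is_arg_min ?F (\<lambda>_. True) b"
    unfolding is_arg_min_def using I by (metis add_0_right leD order_trans)
  then have "is_arg_min ?F (\<lambda>_. True) (arg_min ?F (\<lambda>_. True))"
    unfolding arg_min_def by (rule someI)
  moreover have "arg_min ?F (\<lambda>_. True) = barycenter x n"
    unfolding barycenter_def frechet_functional_def ..
  ultimately show ?thesis
    unfolding is_arg_min_def by (metis not_less)
qed

text \<open>
Moving from the minimizer b towards z by a small t cannot decrease the functional. Dividing the
strong convexity bound by t and letting t tend to 0 gives the quadratic growth with constant 1.
\<close>

lemma variance_inequality:
  fixes x :: "nat \<Rightarrow> 'a::hadamard_space"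
  assumes n: "n \<ge> 1"
  shows "frechet_functional x n (barycenter x n) + (dist z (barycenter x n))\<^sup>2 \<le> frechet_functional x n z"
proof -
  let ?F = "frechet_functional x n" and ?b = "barycenter x n"
  have le: "(1 - t) * (dist ?b z)\<^sup>2 \<le> ?F z - ?F ?b" if t: "t \<in> {0<..1}" for t
  proof -
    have "?F ?b \<le> (1 - t) * ?F ?b + t * ?F z - t * (1 - t) * (dist ?b z)\<^sup>2"
      using frechet_barycenter_le[OF n, of x "geodesic_point ?b t z"]
        frechet_geodesic_point[OF n, of t x ?b z] t by auto
    then have "t * ((1 - t) * (dist ?b z)\<^sup>2) \<le> t * (?F z - ?F ?b)"
      by (simp add: algebra_simps)
    then show ?thesis using t by simp
  qed
  have "((\<lambda>t. (1 - t) * (dist ?b z)\<^sup>2) \<longlongrightarrow> (1 - 0) * (dist ?b z)\<^sup>2) (at_right 0)"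
    by (intro tendsto_intros)
  moreover have "eventually (\<lambda>t::real. t \<in> {0<..1}) (at_right 0)"
    by (auto simp: eventually_at_right_field intro: exI[of _ 1])
  then have "eventually (\<lambda>t. (1 - t) * (dist ?b z)\<^sup>2 \<le> ?F z - ?F ?b) (at_right 0)"
    by eventually_elim (rule le)
  ultimately have "(1 - 0) * (dist ?b z)\<^sup>2 \<le> ?F z - ?F ?b"
    by (intro tendsto_upperbound) auto
  then show ?thesis by (simp add: dist_commute algebra_simps)
qed

lemma barycenter_in_cball:
  fixes x :: "nat \<Rightarrow> 'a::hadamard_space"
  assumes n: "n \<ge> 1" and x: "x ` {1..n} \<subseteq> cball z R" and R: "R \<ge> 0"
  shows "barycenter x n \<in> cball z R"
proof -
  have "(dist z (barycenter x n))\<^sup>2 \<le> frechet_functional x n z"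
    using variance_inequality[OF n, of x z] frechet_nonneg[of x n "barycenter x n"] by linarith
  also have "\<dots> \<le> (1 / real n) * (\<Sum>k=1..n. R\<^sup>2)"
    unfolding frechet_functional_def using x
    by (intro mult_left_mono sum_mono power_mono) (auto simp: dist_commute image_subset_iff)
  also have "\<dots> = R\<^sup>2" using n by simp
  finally show ?thesis using R by (auto intro: power2_le_imp_le)
qed

text \<open>
Each squared distance changes by at most d(b, w) times the sum of the two distances involved, which are
bounded by R + d(z, w) and by 2 R.
\<close>

lemma frechet_le_frechet_barycenter:
  fixes x :: "nat \<Rightarrow> 'a::hadamard_space"
  assumes n: "n \<ge> 1" and x: "x ` {1..n} \<subseteq> cball z R" and R: "R \<ge> 0"
  shows "frechet_functional x n w \<le> frechet_functional x n (barycenter x n) + dist (barycenter x n) w * (3 * R + dist z w)"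
proof -
  let ?b = "barycenter x n"
  let ?B = "dist ?b w * (3 * R + dist z w)"
  have "(dist (x k) w)\<^sup>2 \<le> (dist (x k) ?b)\<^sup>2 + ?B" if k: "k \<in> {1..n}" for k
  proof -
    have z: "dist z (x k) \<le> R" "dist z ?b \<le> R"
      using x k barycenter_in_cball[OF assms] by (auto simp: image_subset_iff)
    have 1: "dist (x k) w - dist (x k) ?b \<le> dist ?b w"
      using dist_triangle[of "x k" w ?b] by simp
    have 2: "dist (x k) w \<le> R + dist z w" "dist (x k) ?b \<le> 2 * R"
      using dist_triangle[of "x k" w z] dist_triangle[of "x k" ?b z] z by (auto simp: dist_commute)
    have "(dist (x k) w)\<^sup>2 - (dist (x k) ?b)\<^sup>2
        = (dist (x k) w - dist (x k) ?b) * (dist (x k) w + dist (x k) ?b)"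
      by (simp add: power2_eq_square algebra_simps)
    also have "\<dots> \<le> dist ?b w * (dist (x k) w + dist (x k) ?b)"
      by (intro mult_right_mono 1) auto
    also have "\<dots> \<le> ?B"
      using 2 by (intro mult_left_mono) auto
    finally show ?thesis by simp
  qed
  then have "frechet_functional x n w \<le> (1 / real n) * (\<Sum>k=1..n. (dist (x k) ?b)\<^sup>2 + ?B)"
    unfolding frechet_functional_def by (intro mult_left_mono sum_mono) auto
  also have "\<dots> = frechet_functional x n ?b + ?B"
    using n unfolding frechet_functional_def by (simp add: sum.distrib field_simps)
  finally show ?thesis .
qed

section \<open>The inductive mean\<close>

text \<open>
The contraction factor is 1 - 2/n rather than 1 - 1/n: one half of it comes from convexity along the
geodesic, the other from the quadratic growth of the Frechet functional around its minimizer.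
\<close>

lemma mean_square_after_step_le:
  fixes x :: "nat \<Rightarrow> 'a::hadamard_space"
  assumes n: "n \<ge> 1" and x: "x ` {1..n} \<subseteq> cball z R" and R: "R \<ge> 0" and u: "u \<in> cball z R"
  shows "(1 / real n) * (\<Sum>i=1..n. (dist (geodesic_point u (1 / real n) (x i)) w)\<^sup>2)
    \<le> (1 - 2 / real n) * (dist u w)\<^sup>2
      + (dist (barycenter x n) w * (5 * R + 3 * dist z w) / real n + 4 * R\<^sup>2 / (real n)\<^sup>2)"
proof -
  let ?b = "barycenter x n" and ?t = "1 / real n" and ?D = "dist z w" and ?F = "frechet_functional x n"
  have t: "?t \<in> {0..1}" using n by auto
  have "(1 / real n) * (\<Sum>i=1..n. (dist (geodesic_point u ?t (x i)) w)\<^sup>2)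
     \<le> (1 / real n) * (\<Sum>i=1..n. (1 - ?t) * (dist u w)\<^sup>2 + ?t * (dist (x i) w)\<^sup>2
          - ?t * (1 - ?t) * (dist (x i) u)\<^sup>2)"
  proof (intro mult_left_mono sum_mono)
    show "(dist (geodesic_point u ?t (x i)) w)\<^sup>2 \<le> (1 - ?t) * (dist u w)\<^sup>2
        + ?t * (dist (x i) w)\<^sup>2 - ?t * (1 - ?t) * (dist (x i) u)\<^sup>2" for i
      using geodesic_point_ineq[OF t, of w u "x i"] by (simp add: dist_commute)
  qed simp
  also have "\<dots> = (1 - ?t) * (dist u w)\<^sup>2 + ?t * ?F w - ?t * (1 - ?t) * ?F u"
  proof -
    have "(1 / real n) * (\<Sum>i=1..n. c + t * f i - s * g i)
        = c + t * (1 / real n * sum f {1..n}) - s * (1 / real n * sum g {1..n})" for c t s f g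
    proof -
      have e: "(\<Sum>i=1..n. c + t * f i - s * g i) = real n * c + t * sum f {1..n} - s * sum g {1..n}"
        by (simp add: sum_subtractf sum.distrib sum_distrib_left)
      show ?thesis unfolding e using n by (simp add: field_simps)
    qed
    then show ?thesis unfolding frechet_functional_def .
  qed
  also have "\<dots> = (1 - ?t) * (dist u w)\<^sup>2 + ?t * (?F w - ?F u) + ?t * (?t * ?F u)"
    by (simp add: algebra_simps)
  also have "\<dots> \<le> (1 - ?t) * (dist u w)\<^sup>2
      + ?t * (dist ?b w * (5 * R + 3 * ?D) - (dist u w)\<^sup>2) + ?t * (?t * (4 * R\<^sup>2))"
  proof (intro add_mono mult_left_mono order_refl)
    \<comment> \<open>quadratic growth around the barycenter, transferred from the barycenter to \<open>w\<close>\<close>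
    have "dist u w - dist ?b w \<le> dist u ?b" "dist ?b w - dist u w \<le> dist u ?b"
      using dist_triangle[of u w ?b] dist_triangle[of ?b w u] by (simp_all add: dist_commute)
    then have "(dist u w - dist ?b w)\<^sup>2 \<le> (dist u ?b)\<^sup>2"
      by (simp add: abs_le_square_iff[symmetric])
    moreover have "(dist u w - dist ?b w)\<^sup>2 \<ge> (dist u w)\<^sup>2 - dist ?b w * (2 * dist u w)"
      by (simp add: power2_diff)
    moreover have "dist ?b w * (2 * dist u w) \<le> dist ?b w * (2 * (R + ?D))"
      using u dist_triangle[of u w z] by (intro mult_left_mono) (auto simp: dist_commute)
    ultimately have "(dist u w)\<^sup>2 - dist ?b w * (2 * (R + ?D)) \<le> (dist u ?b)\<^sup>2"
      by linarith
    then have "?F w - ?F u \<le> dist ?b w * (3 * R + ?D) + dist ?b w * (2 * (R + ?D)) - (dist u w)\<^sup>2"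
      using variance_inequality[OF n, of x u] frechet_le_frechet_barycenter[OF n x R, of w]
      by linarith
    then show "?F w - ?F u \<le> dist ?b w * (5 * R + 3 * ?D) - (dist u w)\<^sup>2"
      by (simp add: algebra_simps)
    have d: "dist (x k) u \<le> 2 * R" if "k \<in> {1..n}" for k
    proof -
      have "dist z (x k) \<le> R" "dist z u \<le> R"
        using that x u by (auto simp: image_subset_iff)
      then show ?thesis using dist_triangle[of "x k" u z] by (simp add: dist_commute)
    qed
    have "?F u \<le> (1 / real n) * (\<Sum>k=1..n. (2 * R)\<^sup>2)"
      unfolding frechet_functional_def by (intro mult_left_mono sum_mono power_mono d) auto
    then show "?F u \<le> 4 * R\<^sup>2" using n by (simp add: power_mult_distrib)
  qed (use t in auto)
  also have "\<dots> = (1 - 2 / real n) * (dist u w)\<^sup>2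
      + (dist ?b w * (5 * R + 3 * ?D) / real n + 4 * R\<^sup>2 / (real n)\<^sup>2)"
    using n by (simp add: field_simps power2_eq_square)
  finally show ?thesis .
qed

text \<open>
The value at 0 is immaterial, since the first step has weight 1 and ends at y 1. Starting the recursion
there avoids a separate equation for n = 1.
\<close>

fun inductive_mean :: "(nat \<Rightarrow> 'a::hadamard_space) \<Rightarrow> nat \<Rightarrow> 'a" where
  "inductive_mean y 0 = undefined"
| "inductive_mean y (Suc n) = geodesic_point (inductive_mean y n) (1 / real (Suc n)) (y (Suc n))"

lemma inductive_mean_1: "inductive_mean y 1 = y 1"
  by (simp add: geodesic_point_1)

lemma inductive_mean_cong:
  "(\<And>k. k \<in> {1..n} \<Longrightarrow> y k = y' k) \<Longrightarrow> inductive_mean y n = inductive_mean y' n"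
  by (induction n) auto

lemma inductive_mean_in_cball:
  assumes "n \<ge> 1" "\<And>k. k \<in> {1..n} \<Longrightarrow> y k \<in> cball z r"
  shows "inductive_mean y n \<in> cball z r"
  using assms
proof (induction n rule: nat_induct_at_least)
  case base
  then show ?case using inductive_mean_1[of y] by auto
next
  case (Suc n)
  then show ?case
    by (auto intro!: geodesic_point_in_cball simp del: mem_cball)
qed

lemma inductive_mean_step_le:
  assumes "n \<ge> 1" "\<And>k. k \<in> {1..Suc n} \<Longrightarrow> y k \<in> cball z r"
  shows "dist (inductive_mean y (Suc n)) (inductive_mean y n) \<le> 2 * r / real (Suc n)"
proof -
  have 1: "inductive_mean y n \<in> cball z r" "y (Suc n) \<in> cball z r"
    using assms by (auto intro!: inductive_mean_in_cball simp del: mem_cball)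
  then have "dist (inductive_mean y n) (y (Suc n)) \<le> 2 * r"
    using dist_triangle[of "inductive_mean y n" "y (Suc n)" z] by (simp add: dist_commute)
  moreover have "dist (inductive_mean y (Suc n)) (inductive_mean y n)
      = 1 / real (Suc n) * dist (inductive_mean y n) (y (Suc n))"
    unfolding inductive_mean.simps by (subst dist_commute, subst dist_geodesic_point_left) auto
  ultimately show ?thesis by (simp add: field_simps)
qed

section \<open>From the recursion to convergence\<close>

text \<open>
The factor n (n - 1) turns 1 - 2/n into (n - 1) (n - 2), so the left-hand side telescopes.
\<close>

lemma contracting_recursion_bound:
  fixes a d :: "nat \<Rightarrow> real"
  assumes d: "\<And>n. d n \<ge> 0"
    and step: "\<And>n. n \<ge> 1 \<Longrightarrow> a (Suc n) \<le> (1 - 2 / real (Suc n)) * a n + d (Suc n)"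
    and n: "n \<ge> 1"
  shows "real n * (real n - 1) * a n \<le> (\<Sum>k=1..n. (real k)\<^sup>2 * d k)"
  using n
proof (induction n rule: nat_induct_at_least)
  case base
  then show ?case using d by simp
next
  case (Suc n)
  have "real (Suc n) * real n * a (Suc n)
      \<le> real (Suc n) * real n * ((1 - 2 / real (Suc n)) * a n + d (Suc n))"
    by (intro mult_left_mono step Suc.hyps) auto
  also have "\<dots> = real n * (real n - 1) * a n + real (Suc n) * real n * d (Suc n)"
    by (simp add: field_simps)
  also have "\<dots> \<le> (\<Sum>k=1..n. (real k)\<^sup>2 * d k) + (real (Suc n))\<^sup>2 * d (Suc n)"
    unfolding power2_eq_square[of "real (Suc n)"]
    by (intro add_mono Suc.IH mult_right_mono mult_left_mono d) auto
  finally show ?case by simp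
qed

text \<open>
Only the averages of \<epsilon> are controlled, not its single values. That suffices, since after telescoping
the weights k^(1+q) of \<epsilon>_k can be replaced by their maximum n^(1+q). The result is
a_n = O(n^(q-p) + n^(2q-1)), and at n = k^2 the exponents 2 (q - p) and 4 q - 2 are below -1.
\<close>

lemma summable_square_subsequence_of_recursion:
  fixes a \<epsilon> :: "nat \<Rightarrow> real"
  assumes a: "\<And>n. a n \<ge> 0" and \<epsilon>: "\<And>n. \<epsilon> n \<ge> 0" and C: "C \<ge> 0" and D: "D \<ge> 0"
    and q: "0 \<le> q" "q < 1 / 4" "q < p - 1 / 2"
    and avg: "(\<lambda>n. (1 / real n) * (\<Sum>k=1..n. \<epsilon> k)) \<in> O(\<lambda>n. real n powr (- p))"
    and step: "\<And>n. n \<ge> 1 \<Longrightarrow> a (Suc n) \<le> (1 - 2 / real (Suc n)) * a n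
      + (\<epsilon> (Suc n) * (5 * (C * real (Suc n) powr q) + 3 * D) / real (Suc n)
         + 4 * (C * real (Suc n) powr q)\<^sup>2 / (real (Suc n))\<^sup>2)"
  shows "summable (\<lambda>k. a (k\<^sup>2))"
proof -
  define d where "d n = \<epsilon> n * (5 * (C * real n powr q) + 3 * D) / real n
         + 4 * (C * real n powr q)\<^sup>2 / (real n)\<^sup>2" for n
  define K where "K = 5 * C + 3 * D"
  have d0: "d n \<ge> 0" for n
    unfolding d_def using \<epsilon> C D by (intro add_nonneg_nonneg divide_nonneg_nonneg mult_nonneg_nonneg) auto
  obtain B where B: "B > 0"
    "eventually (\<lambda>n. norm ((1 / real n) * (\<Sum>k=1..n. \<epsilon> k)) \<le> B * norm (real n powr (- p))) sequentially"
    using landau_o.bigE[OF avg] by blast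
  have "eventually (\<lambda>n. a n \<le> 2 * K * B * (real n powr q * real n powr (- p))
      + 8 * C\<^sup>2 * ((real n powr q)\<^sup>2 / real n)) sequentially"
    using B(2) eventually_ge_at_top[of 2]
  proof eventually_elim
    case (elim n)
    define Q where "Q = real n powr q"
    have Q1: "Q \<ge> 1" unfolding Q_def using elim(2) q(1) by (intro ge_one_powr_ge_zero) auto
    have S: "(\<Sum>k=1..n. \<epsilon> k) \<le> real n * (B * real n powr (- p))"
      using elim by (simp add: sum_nonneg \<epsilon> field_simps)
    have "(real k)\<^sup>2 * d k \<le> real n * K * Q * \<epsilon> k + 4 * C\<^sup>2 * Q\<^sup>2" if k: "k \<in> {1..n}" for k
    proof -
      have kQ: "real k powr q \<le> Q" unfolding Q_def using k q by (intro powr_mono2) auto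
      have "5 * (C * real k powr q) + 3 * D \<le> 5 * (C * Q) + 3 * D * Q"
        using kQ C D Q1 mult_left_mono[OF Q1, of "3 * D"] by (intro add_mono mult_left_mono) auto
      also have "\<dots> = K * Q" unfolding K_def by (simp add: algebra_simps)
      finally have "real k * (5 * (C * real k powr q) + 3 * D) \<le> real n * (K * Q)"
        using k C D by (intro mult_mono) auto
      then have "real k * (5 * (C * real k powr q) + 3 * D) * \<epsilon> k \<le> real n * (K * Q) * \<epsilon> k"
        using \<epsilon> by (rule mult_right_mono)
      moreover have "4 * (C * real k powr q)\<^sup>2 \<le> 4 * (C * Q)\<^sup>2"
        using kQ C by (intro mult_left_mono power_mono) auto
      moreover have "(real k)\<^sup>2 * d k = real k * (5 * (C * real k powr q) + 3 * D) * \<epsilon> k + 4 * (C * real k powr q)\<^sup>2"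
      proof -
        have "r\<^sup>2 * (e * X / r + Y / r\<^sup>2) = r * X * e + Y" if "r \<noteq> 0" for r e X Y :: real
          using that by (simp add: field_simps power2_eq_square)
        then show ?thesis using k unfolding d_def by simp
      qed
      ultimately show ?thesis by (simp add: power_mult_distrib mult.assoc)
    qed
    then have "(\<Sum>k=1..n. (real k)\<^sup>2 * d k) \<le> (\<Sum>k=1..n. real n * K * Q * \<epsilon> k + 4 * C\<^sup>2 * Q\<^sup>2)"
      by (rule sum_mono)
    also have "\<dots> = real n * K * Q * (\<Sum>k=1..n. \<epsilon> k) + real n * (4 * C\<^sup>2 * Q\<^sup>2)"
      by (simp add: sum.distrib sum_distrib_left)
    also have "\<dots> \<le> real n * K * Q * (real n * (B * real n powr (- p))) + real n * (4 * C\<^sup>2 * Q\<^sup>2)"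
      using S Q1 C D unfolding K_def by (intro add_mono mult_left_mono) auto
    also have "\<dots> = (real n)\<^sup>2 / 2 * (2 * K * B * (Q * real n powr (- p)) + 8 * C\<^sup>2 * (Q\<^sup>2 / real n))"
      using elim(2) by (simp add: field_simps power2_eq_square)
    finally have 1: "(\<Sum>k=1..n. (real k)\<^sup>2 * d k)
        \<le> (real n)\<^sup>2 / 2 * (2 * K * B * (Q * real n powr (- p)) + 8 * C\<^sup>2 * (Q\<^sup>2 / real n))" .
    have "real n * (real n - 1) * a n \<le> (\<Sum>k=1..n. (real k)\<^sup>2 * d k)"
      by (rule contracting_recursion_bound[OF d0 step[folded d_def]]) (use elim(2) in auto)
    moreover have "real n / 2 \<le> real n - 1" using elim(2) by simp
    then have "real n * (real n / 2) * a n \<le> real n * (real n - 1) * a n"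
      by (intro mult_right_mono mult_left_mono a) auto
    ultimately have "(real n)\<^sup>2 / 2 * a n
        \<le> (real n)\<^sup>2 / 2 * (2 * K * B * (Q * real n powr (- p)) + 8 * C\<^sup>2 * (Q\<^sup>2 / real n))"
      using 1 by (simp add: power2_eq_square)
    then show ?case
      unfolding Q_def using elim(2) by (subst (asm) mult_le_cancel_left_pos) auto
  qed
  then obtain N where N: "\<And>n. n \<ge> N \<Longrightarrow> a n \<le> 2 * K * B * (real n powr q * real n powr (- p))
      + 8 * C\<^sup>2 * ((real n powr q)\<^sup>2 / real n)"
    unfolding eventually_sequentially by blast
  show ?thesis
  proof (rule summable_comparison_test_ev)
    show "eventually (\<lambda>k. norm (a (k\<^sup>2)) \<le> 2 * K * B * real k powr (2 * (q - p))
        + 8 * C\<^sup>2 * real k powr (4 * q - 2)) sequentially"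
      using eventually_ge_at_top[of "max 1 N"]
    proof eventually_elim
      case (elim k)
      then have k: "real k > 0" by simp
      have sq: "real (k\<^sup>2) = real k powr 2" using k by (simp add: powr_numeral)
      have "k \<le> k\<^sup>2" by (simp add: power2_eq_square)
      then have "a (k\<^sup>2) \<le> 2 * K * B * (real (k\<^sup>2) powr q * real (k\<^sup>2) powr (- p))
          + 8 * C\<^sup>2 * ((real (k\<^sup>2) powr q)\<^sup>2 / real (k\<^sup>2))"
        using elim by (intro N) linarith
      also have "real (k\<^sup>2) powr q * real (k\<^sup>2) powr (- p) = real k powr (2 * (q - p))"
        unfolding sq powr_powr by (simp add: powr_add[symmetric] algebra_simps)
      also have "(real (k\<^sup>2) powr q)\<^sup>2 / real (k\<^sup>2) = real k powr (4 * q - 2)"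
        unfolding sq powr_powr using k
        by (simp add: power2_eq_square powr_add[symmetric] powr_diff)
      finally show ?case using a by simp
    qed
    show "summable (\<lambda>k. 2 * K * B * real k powr (2 * (q - p)) + 8 * C\<^sup>2 * real k powr (4 * q - 2))"
      using q by (intro summable_add summable_mult) (simp_all add: summable_real_powr_iff)
  qed
qed

text \<open>
From k^2 to an index below the next square there are at most 2k steps of length at most c k^(2r) each, and their total
2 c k^(1+2r) tends to 0 since r < -1/2.
\<close>

lemma tendsto_of_square_subsequence:
  fixes m :: "nat \<Rightarrow> 'a::metric_space"
  assumes lim: "(\<lambda>k. m (k\<^sup>2)) \<longlonglongrightarrow> l"
    and step: "\<And>n. n \<ge> 1 \<Longrightarrow> dist (m (Suc n)) (m n) \<le> c * real (Suc n) powr r"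
    and c: "c \<ge> 0" and r: "r < - 1 / 2"
  shows "m \<longlonglongrightarrow> l"
proof -
  define G where "G k = 2 * c * real k powr (1 + 2 * r) + dist (m (k\<^sup>2)) l" for k
  have step': "dist (m (k\<^sup>2 + j)) (m (k\<^sup>2)) \<le> real j * (c * real k powr (2 * r))" if "k \<ge> 1" for k j
  proof (induction j)
    case (Suc j)
    have "real k ^ 2 \<le> real (Suc (k\<^sup>2 + j))" by simp
    then have "real (Suc (k\<^sup>2 + j)) powr r \<le> (real k ^ 2) powr r"
      using that r by (intro powr_mono2') auto
    also have "(real k ^ 2) powr r = real k powr (2 * r)"
      using that by (simp add: powr_powr flip: powr_numeral)
    finally have "c * real (Suc (k\<^sup>2 + j)) powr r \<le> c * real k powr (2 * r)"
      using c by (rule mult_left_mono)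
    moreover have "dist (m (Suc (k\<^sup>2 + j))) (m (k\<^sup>2 + j)) \<le> c * real (Suc (k\<^sup>2 + j)) powr r"
      using that by (intro step) (auto simp: Suc_le_eq)
    moreover have "dist (m (k\<^sup>2 + Suc j)) (m (k\<^sup>2))
        \<le> dist (m (Suc (k\<^sup>2 + j))) (m (k\<^sup>2 + j)) + dist (m (k\<^sup>2 + j)) (m (k\<^sup>2))"
      using dist_triangle by simp
    ultimately show ?case using Suc.IH by (simp add: algebra_simps)
  qed simp
  have "dist (m n) l \<le> G (floor_sqrt n)" if n: "n \<ge> 1" for n
  proof -
    define k where "k = floor_sqrt n"
    define j where "j = n - k\<^sup>2"
    have k: "k \<ge> 1" using n floor_sqrt_greater_zero_iff[of n] unfolding k_def by linarith
    have "k\<^sup>2 \<le> n" unfolding k_def by simp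
    then have nj: "n = k\<^sup>2 + j" unfolding j_def by simp
    have "n < (Suc k)\<^sup>2" unfolding k_def by (rule Suc_floor_sqrt_power2_gt)
    then have j: "j \<le> 2 * k" unfolding nj by (simp add: power2_eq_square)
    have "dist (m n) (m (k\<^sup>2)) \<le> real j * (c * real k powr (2 * r))"
      unfolding nj by (rule step'[OF k])
    also have "\<dots> \<le> real (2 * k) * (c * real k powr (2 * r))"
      using j c by (intro mult_right_mono) auto
    also have "\<dots> = 2 * c * real k powr (1 + 2 * r)"
      using k by (simp add: powr_add)
    finally show ?thesis
      unfolding G_def k_def[symmetric] using dist_triangle[of "m n" l "m (k\<^sup>2)"] by linarith
  qed
  moreover have "filterlim floor_sqrt at_top sequentially"
    unfolding filterlim_at_top
  proof
    fix Z :: nat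
    show "eventually (\<lambda>n. Z \<le> floor_sqrt n) sequentially"
      using eventually_ge_at_top[of "Z\<^sup>2"]
      by eventually_elim (metis floor_sqrt_inverse_power2 mono_floor_sqrt')
  qed
  moreover have "G \<longlonglongrightarrow> 0"
  proof -
    have "(\<lambda>k. real k powr (1 + 2 * r)) \<longlonglongrightarrow> 0"
      using r by (intro tendsto_neg_powr filterlim_real_sequentially) auto
    moreover have "(\<lambda>k. dist (m (k\<^sup>2)) l) \<longlonglongrightarrow> 0"
      using lim by (rule tendsto_dist_iff[THEN iffD1])
    ultimately have "G \<longlonglongrightarrow> 2 * c * 0 + 0"
      unfolding G_def by (intro tendsto_intros)
    then show ?thesis by simp
  qed
  ultimately have G: "(\<lambda>n. G (floor_sqrt n)) \<longlonglongrightarrow> 0" and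
    le: "\<And>n. n \<ge> 1 \<Longrightarrow> dist (m n) l \<le> G (floor_sqrt n)"
    by (auto intro: filterlim_compose)
  have "(\<lambda>n. dist (m n) l) \<longlonglongrightarrow> 0"
  proof (rule Lim_null_comparison[OF _ G])
    show "eventually (\<lambda>n. norm (dist (m n) l) \<le> G (floor_sqrt n)) sequentially"
      using eventually_ge_at_top[of 1] by eventually_elim (simp add: le)
  qed
  then show ?thesis by (rule tendsto_dist_iff[THEN iffD2])
qed

section \<open>Almost sure convergence and finite-valued random variables\<close>

text \<open>
The sum of the f k has finite expectation, so it is finite almost surely and its terms tend to 0.
\<close>

lemma (in prob_space) AE_tendsto_0_if_summable_expectation:
  fixes f :: "nat \<Rightarrow> 'a \<Rightarrow> real"
  assumes int: "\<And>k. integrable M (f k)" and pos: "\<And>k \<omega>. f k \<omega> \<ge> 0"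
    and sum: "summable (\<lambda>k. expectation (f k))"
  shows "AE \<omega> in M. (\<lambda>k. f k \<omega>) \<longlonglongrightarrow> 0"
proof -
  note [measurable] = borel_measurable_integrable[OF int]
  have "(\<integral>\<^sup>+\<omega>. (\<Sum>k. ennreal (f k \<omega>)) \<partial>M) = (\<Sum>k. \<integral>\<^sup>+\<omega>. ennreal (f k \<omega>) \<partial>M)"
    by (intro nn_integral_suminf) measurable
  also have "\<dots> = (\<Sum>k. ennreal (expectation (f k)))"
    by (intro suminf_cong nn_integral_eq_integral int) (auto simp: pos)
  also have "\<dots> = ennreal (\<Sum>k. expectation (f k))"
    by (intro suminf_ennreal2 sum integral_nonneg_AE) (auto simp: pos)
  finally have "(\<integral>\<^sup>+\<omega>. (\<Sum>k. ennreal (f k \<omega>)) \<partial>M) \<noteq> \<infinity>" by simp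
  then have "AE \<omega> in M. (\<Sum>k. ennreal (f k \<omega>)) \<noteq> \<infinity>"
    by (intro nn_integral_PInf_AE) measurable
  then show ?thesis
    by eventually_elim (auto intro!: summable_LIMSEQ_zero summable_suminf_not_top pos)
qed

text \<open>
Finite sets are closed, so each level set is a Borel set. This is the passage from the Borel algebra, whose
products can miss open sets when the space is not separable, to discrete spaces.
\<close>

lemma measurable_retract_to_finite:
  fixes V :: "'a::t1_space set"
  assumes "finite V" "v \<in> V"
  shows "(\<lambda>w. if w \<in> V then w else v) \<in> measurable borel (count_space V)"
  unfolding measurable_count_space_eq2[OF assms(1)]
proof (intro conjI ballI)
  fix a assume "a \<in> V"
  then have "(\<lambda>w. if w \<in> V then w else v) -` {a} \<inter> space borel = (if a = v then {a} \<union> - V else {a})"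
    by auto
  also have "\<dots> \<in> sets borel"
    using finite_imp_closed[OF assms(1)] by (auto intro!: borel_closed borel_comp)
  finally show "(\<lambda>w. if w \<in> V then w else v) -` {a} \<inter> space borel \<in> sets borel" .
qed (use assms in auto)

text \<open>
Fubini for the joint law, which is the product of the two laws. Finiteness of the ranges makes an
arbitrary function g measurable and bounded.
\<close>

lemma (in prob_space) indep_expectation_iterated:
  fixes g :: "'b \<Rightarrow> 'b \<Rightarrow> real"
  assumes ind: "indep_var (count_space A) X (count_space B) Y" and fin: "finite A" "finite B"
  shows "expectation (\<lambda>\<omega>. g (X \<omega>) (Y \<omega>)) = expectation (\<lambda>\<omega>. expectation (\<lambda>\<omega>'. g (X \<omega>) (Y \<omega>')))"
proof -
  have X[measurable]: "X \<in> measurable M (count_space A)" and Y[measurable]: "Y \<in> measurable M (count_space B)"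
    using ind by (auto dest: indep_var_rv1 indep_var_rv2)
  let ?P = "distr M (count_space A) X" and ?Q = "distr M (count_space B) Y"
  interpret P: prob_space ?P by (rule prob_space_distr) fact
  interpret Q: prob_space ?Q by (rule prob_space_distr) fact
  interpret PQ: pair_prob_space ?P ?Q ..
  have cs: "count_space A \<Otimes>\<^sub>M count_space B = count_space (A \<times> B)"
    by (rule pair_measure_count_space[OF fin])
  have meas: "case_prod g \<in> borel_measurable (count_space A \<Otimes>\<^sub>M count_space B)"
    unfolding cs by simp
  have XY: "(\<lambda>\<omega>. (X \<omega>, Y \<omega>)) \<in> measurable M (count_space A \<Otimes>\<^sub>M count_space B)"
    by measurable
  have joint: "?P \<Otimes>\<^sub>M ?Q = distr M (count_space A \<Otimes>\<^sub>M count_space B) (\<lambda>\<omega>. (X \<omega>, Y \<omega>))"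
    using ind unfolding indep_var_distribution_eq by blast
  obtain K where K: "\<And>p. p \<in> A \<times> B \<Longrightarrow> norm (case_prod g p) \<le> K"
    using finite_imp_bounded[OF finite_imageI[OF finite_cartesian_product[OF fin]], of "case_prod g"]
    unfolding bounded_iff by (metis imageI)
  have int: "integrable (?P \<Otimes>\<^sub>M ?Q) (case_prod g)"
  proof (rule PQ.integrable_const_bound)
    show "AE p in ?P \<Otimes>\<^sub>M ?Q. norm (case_prod g p) \<le> K"
      by (rule AE_I2, rule K) (auto simp: space_pair_measure)
    show "case_prod g \<in> borel_measurable (?P \<Otimes>\<^sub>M ?Q)"
      unfolding joint using meas by simp
  qed
  have "expectation (\<lambda>\<omega>. g (X \<omega>) (Y \<omega>)) = integral\<^sup>L (?P \<Otimes>\<^sub>M ?Q) (case_prod g)"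
    unfolding joint by (subst integral_distr[OF XY meas]) simp
  also have "\<dots> = (\<integral>a. (\<integral>b. g a b \<partial>?Q) \<partial>?P)"
    using PQ.integral_fst'[OF int] by simp
  also have "\<dots> = (\<integral>a. expectation (\<lambda>\<omega>'. g a (Y \<omega>')) \<partial>?P)"
    by (subst integral_distr[OF Y]) auto
  also have "\<dots> = expectation (\<lambda>\<omega>. expectation (\<lambda>\<omega>'. g (X \<omega>) (Y \<omega>')))"
    by (subst integral_distr[OF X]) auto
  finally show ?thesis .
qed

text \<open>
A finite product of finite discrete spaces is discrete, so every function of the first n values is a
random variable. This applies to the inductive mean, for which no measurability in its arguments is
known.
\<close>

lemma (in prob_space) indep_var_past_next:
  fixes Z :: "nat \<Rightarrow> 'a \<Rightarrow> 'b" and f :: "(nat \<Rightarrow> 'b) \<Rightarrow> 'b"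
  assumes ind: "indep_vars (\<lambda>k. count_space (V k)) Z {1..}" and fin: "\<And>k. finite (V k)"
    and f: "\<And>y. f (restrict y {1..n}) = f y"
  shows "indep_var (count_space (f ` PiE {1..n} V)) (\<lambda>\<omega>. f (\<lambda>k. Z k \<omega>))
                   (count_space (V (Suc n))) (Z (Suc n))"
proof -
  let ?N = "\<lambda>k. count_space (V k)"
  have "indep_var (PiM {1..n} ?N) (\<lambda>\<omega>. restrict (\<lambda>k. Z k \<omega>) {1..n})
                  (PiM {Suc n} ?N) (\<lambda>\<omega>. restrict (\<lambda>k. Z k \<omega>) {Suc n})"
    by (rule indep_var_restrict[OF ind]) auto
  moreover have "PiM {1..n} ?N = count_space (PiE {1..n} V)"
    using fin by (intro count_space_PiM_finite) (auto intro: countable_finite)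
  then have "f \<in> measurable (PiM {1..n} ?N) (count_space (f ` PiE {1..n} V))"
    by auto
  moreover have "(\<lambda>y. y (Suc n)) \<in> measurable (PiM {Suc n} ?N) (?N (Suc n))"
    by (rule measurable_component_singleton) simp
  ultimately have "indep_var (count_space (f ` PiE {1..n} V)) (f \<circ> (\<lambda>\<omega>. restrict (\<lambda>k. Z k \<omega>) {1..n}))
      (?N (Suc n)) ((\<lambda>y. y (Suc n)) \<circ> (\<lambda>\<omega>. restrict (\<lambda>k. Z k \<omega>) {Suc n}))"
    by (rule indep_var_compose)
  then show ?thesis unfolding comp_def f by simp
qed

lemma (in prob_space) integrable_finite_range:
  fixes h :: "'b \<Rightarrow> real"
  assumes "X \<in> measurable M (count_space A)" "finite A"
  shows "integrable M (\<lambda>\<omega>. h (X \<omega>))"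
proof (rule integrable_const_bound)
  have "norm (h (X \<omega>)) \<le> (\<Sum>b\<in>A. \<bar>h b\<bar>)" if "\<omega> \<in> space M" for \<omega>
    using measurable_space[OF assms(1) that] assms(2)
    by (auto intro!: member_le_sum[of "X \<omega>" A "\<lambda>b. \<bar>h b\<bar>"])
  then show "AE \<omega> in M. norm (h (X \<omega>)) \<le> (\<Sum>b\<in>A. \<bar>h b\<bar>)" by (rule AE_I2)
  show "(\<lambda>\<omega>. h (X \<omega>)) \<in> borel_measurable M"
    by (rule measurable_compose[OF assms(1)]) simp
qed

text \<open>
Given the past, the next value is uniform on x 1, ..., x (n + 1), so the conditional expectation is the
finite average bounded in \<open>mean_square_after_step_le\<close>.
\<close>

lemma (in prob_space) expected_square_after_step_le:
  fixes x :: "nat \<Rightarrow> 'b::hadamard_space" and Z :: "nat \<Rightarrow> 'a \<Rightarrow> 'b"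
  assumes ind: "indep_vars (\<lambda>k. count_space (x ` {1..k})) Z {1..}"
    and law: "\<And>k h. k \<ge> 1 \<Longrightarrow> expectation (\<lambda>\<omega>. h (Z k \<omega>)) = (1 / real k) * (\<Sum>i=1..k. h (x i))"
    and x: "x ` {1..Suc n} \<subseteq> cball z R" and R: "R \<ge> 0" and n: "n \<ge> 1"
  shows "expectation (\<lambda>\<omega>. (dist (inductive_mean (\<lambda>k. Z k \<omega>) (Suc n)) w)\<^sup>2)
    \<le> (1 - 2 / real (Suc n)) * expectation (\<lambda>\<omega>. (dist (inductive_mean (\<lambda>k. Z k \<omega>) n) w)\<^sup>2)
      + (dist (barycenter x (Suc n)) w * (5 * R + 3 * dist z w) / real (Suc n)
         + 4 * R\<^sup>2 / (real (Suc n))\<^sup>2)" (is "_ \<le> ?c * _ + ?d")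
proof -
  let ?V = "\<lambda>k. x ` {1..k}"
  define N where "N \<omega> = inductive_mean (\<lambda>k. Z k \<omega>) n" for \<omega>
  define A where "A = (\<lambda>y. inductive_mean y n) ` PiE {1..n} ?V"
  define g where "g u y = (dist (geodesic_point u (1 / real (Suc n)) y) w)\<^sup>2" for u y
  have finA: "finite A" unfolding A_def by (intro finite_imageI finite_PiE) auto
  have indep: "indep_var (count_space A) N (count_space (?V (Suc n))) (Z (Suc n))"
    unfolding A_def N_def
    by (rule indep_var_past_next[OF ind]) (auto intro: inductive_mean_cong)
  have N: "N \<in> measurable M (count_space A)"
    using indep by (rule indep_var_rv1)
  note int = integrable_finite_range[OF N finA]
  have Nball: "N \<omega> \<in> cball z R" if "\<omega> \<in> space M" for \<omega>
    unfolding N_def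
  proof (rule inductive_mean_in_cball[OF n])
    fix k assume k: "k \<in> {1..n}"
    then have "Z k \<in> measurable M (count_space (?V k))"
      using ind unfolding indep_vars_def by auto
    then have "Z k \<omega> \<in> ?V k" using that by (auto dest: measurable_space)
    also have "?V k \<subseteq> ?V (Suc n)" using k by auto
    finally show "Z k \<omega> \<in> cball z R" using x by blast
  qed
  have "expectation (\<lambda>\<omega>. (dist (inductive_mean (\<lambda>k. Z k \<omega>) (Suc n)) w)\<^sup>2)
      = expectation (\<lambda>\<omega>. g (N \<omega>) (Z (Suc n) \<omega>))"
    unfolding g_def N_def by simp
  also have "\<dots> = expectation (\<lambda>\<omega>. expectation (\<lambda>\<omega>'. g (N \<omega>) (Z (Suc n) \<omega>')))"
    by (rule indep_expectation_iterated[OF indep finA]) auto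
  also have "\<dots> = expectation (\<lambda>\<omega>. (1 / real (Suc n)) * (\<Sum>i=1..Suc n. g (N \<omega>) (x i)))"
    by (subst law) auto
  also have "\<dots> \<le> expectation (\<lambda>\<omega>. ?c * (dist (N \<omega>) w)\<^sup>2 + ?d)"
  proof (rule integral_mono)
    show "(1 / real (Suc n)) * (\<Sum>i=1..Suc n. g (N \<omega>) (x i)) \<le> ?c * (dist (N \<omega>) w)\<^sup>2 + ?d"
      if "\<omega> \<in> space M" for \<omega>
      unfolding g_def by (rule mean_square_after_step_le[OF _ x R Nball[OF that]]) simp
  qed (rule int)+
  also have "\<dots> = ?c * expectation (\<lambda>\<omega>. (dist (N \<omega>) w)\<^sup>2) + ?d"
    by (subst Bochner_Integration.integral_add) (auto intro!: int integrable_mult_right simp: prob_space)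
  finally show ?thesis unfolding N_def .
qed

section \<open>Convergence of the inductive mean\<close>

theorem theorem3:
  fixes \<Omega> :: "'w measure"
    and x :: "nat \<Rightarrow> 'a::hadamard_space"
    and Y M :: "nat \<Rightarrow> 'w \<Rightarrow> 'a"
    and \<mu> z :: 'a
    and p q C :: real
  assumes "prob_space \<Omega>"
    and "prob_space.indep_vars \<Omega> (\<lambda>_. borel) Y {1..}"
    and "\<And>k. k \<ge> 1 \<Longrightarrow> distr \<Omega> borel (Y k) = distr (uniform_count_measure {1..k}) borel x"
    and "\<And>\<omega>. \<omega> \<in> space \<Omega> \<Longrightarrow> M 1 \<omega> = Y 1 \<omega>"
    and "\<And>n \<omega>. n \<ge> 2 \<Longrightarrow> \<omega> \<in> space \<Omega> \<Longrightarrow>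
           M n \<omega> = geodesic_point (M (n - 1) \<omega>) (1 / real n) (Y n \<omega>)"
    and "p > 1 / 2"
    and "(\<lambda>n. (1 / real n) * (\<Sum>k=1..n. dist (barycenter x k) \<mu>)) \<in> O(\<lambda>n. real n powr (- p))"
    and "C > 0"
    and "0 \<le> q" and "q < min (1 / 4) (p - 1 / 2)"
    and "\<And>n. n \<ge> 1 \<Longrightarrow> x ` {1..n} \<subseteq> cball z (C * real n powr q)"
  shows "AE \<omega> in \<Omega>. (\<lambda>n. M n \<omega>) \<longlonglongrightarrow> \<mu>"
proof -
  interpret prob_space \<Omega> by (rule assms(1))
  note indepY = assms(2) and lawY = assms(3) and M1 = assms(4) and Mstep = assms(5)
    and avg = assms(7) and C = assms(8) and q0 = assms(9) and q = assms(10) and ball = assms(11)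
  let ?V = "\<lambda>k. x ` {1..k}"
  \<comment> \<open>\<open>Z\<close> is a finite-valued version of \<open>Y\<close>, and \<open>N\<close> the inductive mean that it drives; both agree
      almost surely with the originals from index 1 on\<close>
  define retract where "retract k w = (if w \<in> ?V k then w else x 1)" for k w
  define Z where "Z k \<omega> = retract k (Y k \<omega>)" for k \<omega>
  define N where "N n \<omega> = inductive_mean (\<lambda>k. Z k \<omega>) n" for n \<omega>
  define R where "R n = C * real n powr q" for n
  define v where "v n \<omega> = (dist (N n \<omega>) \<mu>)\<^sup>2" for n \<omega>

  have retract_measurable: "retract k \<in> measurable borel (count_space (?V k))" if "k \<ge> 1" for k
    unfolding retract_def using that by (intro measurable_retract_to_finite) auto
  have indepZ: "indep_vars (\<lambda>k. count_space (?V k)) Z {1..}"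
    unfolding Z_def using indepY by (rule indep_vars_compose2) (rule retract_measurable, simp)
  have Y: "Y k \<in> measurable \<Omega> borel" if "k \<ge> 1" for k
    using indepY that unfolding indep_vars_def by auto
  have xmeas: "x \<in> measurable (uniform_count_measure {1..k}) borel" for k
    by (simp add: measurable_cong_sets[OF sets_uniform_count_measure_count_space refl])
  have lawZ: "expectation (\<lambda>\<omega>. h (Z k \<omega>)) = (1 / real k) * (\<Sum>i=1..k. h (x i))"
    if k: "k \<ge> 1" for k and h :: "'a \<Rightarrow> real"
  proof -
    \<comment> \<open>\<open>h\<close> itself need not be Borel measurable, but its composition with the retraction is\<close>
    have h: "(\<lambda>w. h (retract k w)) \<in> borel_measurable borel"
      by (rule measurable_compose[OF retract_measurable[OF k]]) simp
    have "expectation (\<lambda>\<omega>. h (Z k \<omega>)) = (\<integral>w. h (retract k w) \<partial>distr \<Omega> borel (Y k))"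
      unfolding Z_def by (rule integral_distr[OF Y[OF k] h, symmetric])
    also have "\<dots> = (\<integral>i. h (retract k (x i)) \<partial>uniform_count_measure {1..k})"
      unfolding lawY[OF k] by (rule integral_distr[OF xmeas h])
    also have "\<dots> = (\<Sum>i=1..k. h (retract k (x i))) / real k"
      by (simp add: integral_uniform_count_measure)
    also have "(\<Sum>i=1..k. h (retract k (x i))) = (\<Sum>i=1..k. h (x i))"
      by (intro sum.cong) (auto simp: retract_def)
    finally show ?thesis by simp
  qed
  have R: "R n \<ge> 0" for n unfolding R_def using C by simp
  have ballR: "x ` {1..n} \<subseteq> cball z (R n)" if "n \<ge> 1" for n
    unfolding R_def by (rule ball[OF that])

  have "summable (\<lambda>k. expectation (v (k\<^sup>2)))"
  proof (rule summable_square_subsequence_of_recursion[where a = "\<lambda>n. expectation (v n)"])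
    show "(\<lambda>n. (1 / real n) * (\<Sum>k=1..n. dist (barycenter x k) \<mu>)) \<in> O(\<lambda>n. real n powr (- p))"
      by (rule avg)
    show "expectation (v n) \<ge> 0" for n unfolding v_def by (rule integral_nonneg_AE) simp
    show "expectation (v (Suc n)) \<le> (1 - 2 / real (Suc n)) * expectation (v n)
      + (dist (barycenter x (Suc n)) \<mu> * (5 * (C * real (Suc n) powr q) + 3 * dist z \<mu>) / real (Suc n)
         + 4 * (C * real (Suc n) powr q)\<^sup>2 / (real (Suc n))\<^sup>2)" if "n \<ge> 1" for n
      using expected_square_after_step_le[OF indepZ lawZ ballR[of "Suc n"] R that, of \<mu>]
      unfolding v_def N_def R_def by simp
  qed (use C q0 q in auto)
  moreover have "integrable \<Omega> (v n)" for n
  proof -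
    have "indep_var (count_space ((\<lambda>y. inductive_mean y n) ` PiE {1..n} ?V)) (N n)
        (count_space (?V (Suc n))) (Z (Suc n))"
      unfolding N_def by (rule indep_var_past_next[OF indepZ]) (auto intro: inductive_mean_cong)
    then have "N n \<in> measurable \<Omega> (count_space ((\<lambda>y. inductive_mean y n) ` PiE {1..n} ?V))"
      by (rule indep_var_rv1)
    then show ?thesis
      unfolding v_def by (rule integrable_finite_range) (auto intro: finite_PiE)
  qed
  moreover have "v n \<omega> \<ge> 0" for n \<omega> unfolding v_def by simp
  ultimately have "AE \<omega> in \<Omega>. (\<lambda>k. v (k\<^sup>2) \<omega>) \<longlonglongrightarrow> 0"
    by (intro AE_tendsto_0_if_summable_expectation)
  moreover have "AE \<omega> in \<Omega>. \<forall>k\<in>{1..}. Y k \<omega> \<in> ?V k"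
  proof (subst AE_ball_countable, simp, intro ballI)
    fix k :: nat assume "k \<in> {1..}"
    then have k: "k \<ge> 1" by simp
    have V: "{w \<in> space borel. w \<in> ?V k} \<in> sets borel"
      using finite_imp_closed[of "?V k"] by (auto intro: borel_closed)
    have "AE i in uniform_count_measure {1..k}. x i \<in> ?V k"
      by (rule AE_I2) (simp add: space_uniform_count_measure)
    then have "AE w in distr \<Omega> borel (Y k). w \<in> ?V k"
      unfolding lawY[OF k] by (subst AE_distr_iff[OF xmeas V])
    then show "AE \<omega> in \<Omega>. Y k \<omega> \<in> ?V k"
      by (subst (asm) AE_distr_iff[OF Y[OF k] V])
  qed
  ultimately show ?thesis
    using AE_space
  proof eventually_elim
    case (elim \<omega>)
    have Y_in: "Y k \<omega> \<in> ?V k" if "k \<ge> 1" for k using elim(2) that by auto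
    have ZY: "Z k \<omega> = Y k \<omega>" if "k \<ge> 1" for k
      using Y_in[OF that] unfolding Z_def retract_def by simp
    have MN: "M n \<omega> = N n \<omega>" if "n \<ge> 1" for n
      using that
    proof (induction n rule: nat_induct_at_least)
      case base
      show ?case
        using M1[OF elim(3)] ZY[of 1] inductive_mean_1[of "\<lambda>k. Z k \<omega>"] by (simp add: N_def)
    next
      case (Suc n)
      show ?case
        using Mstep[of "Suc n", OF _ elim(3)] Suc ZY[of "Suc n"] by (simp add: N_def)
    qed
    have Z_ball: "Z k \<omega> \<in> cball z (R n)" if "k \<in> {1..n}" for k n
    proof -
      have "Z k \<omega> \<in> ?V n" using Y_in[of k] ZY[of k] that by auto
      then show ?thesis using ballR[of n] that by auto
    qed
    \<comment> \<open>from here on the argument is pathwise: convergence along the squares and small gaps\<close>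
    have "(\<lambda>n. N n \<omega>) \<longlonglongrightarrow> \<mu>"
    proof (rule tendsto_of_square_subsequence)
      have "(\<lambda>k. sqrt (v (k\<^sup>2) \<omega>)) \<longlonglongrightarrow> sqrt 0"
        by (intro tendsto_real_sqrt elim)
      then show "(\<lambda>k. N (k\<^sup>2) \<omega>) \<longlonglongrightarrow> \<mu>"
        unfolding v_def by (subst tendsto_dist_iff) simp
      show "dist (N (Suc n) \<omega>) (N n \<omega>) \<le> 2 * C * real (Suc n) powr (q - 1)" if "n \<ge> 1" for n
      proof -
        have "dist (N (Suc n) \<omega>) (N n \<omega>) \<le> 2 * R (Suc n) / real (Suc n)"
          unfolding N_def by (rule inductive_mean_step_le[OF that Z_ball])
        also have "\<dots> = 2 * C * real (Suc n) powr (q - 1)"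
          unfolding R_def by (simp add: powr_diff)
        finally show ?thesis .
      qed
    qed (use C q in auto)
    moreover have "eventually (\<lambda>n. N n \<omega> = M n \<omega>) sequentially"
      using eventually_ge_at_top[of 1] by eventually_elim (simp add: MN)
    ultimately show ?case by (rule Lim_transform_eventually)
  qed
qed

end
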